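(* Let $(x_n)$ be generated by (HPPA). Assume there are monotone functions ${\rm a},{\rm A},{\rm b},{\rm B},{\rm E}:\mathbb{N}\to\mathbb{N}$ satisfying (Q1), (Q2), (Q3'), (Q3), (Q4) respectively. Let $\mathcal{E},\mathcal{D}\in\mathbb{N}$ satisfy $\mathcal{E}\geq 1+\sum_{i=0}^{{\rm E}(0)}\|e_i\|$ and $\mathcal{D}\geq\|x_0-p\|$ for some $p\in S$, and set $N:=\max\{2\mathcal{D},\mathcal{D}+\mathcal{E}\}$. Then for every $k\in\mathbb{N}$ and every monotone $f:\mathbb{N}\to\mathbb{N}$, $$\exists n\leq\Phi_1(k,f)\ \forall i,j\in[n,f(n)]\ \left(\|x_i-x_j\|\leq\frac{1}{k+1}\right),$$ where $\Phi_1(k,f):=\sigma_1(\tilde k,g(\Delta))$ and: $\sigma_1(k',n'):={\rm A}\big(n'+\lceil\ln(16N^2(k'+1))\rceil\big)+1$; $\tilde k:=4(k+1)^2-1$; $g(m):=\max\{m,\ {\rm E}(16(1+4N)(k+1)^2-1)+1\}$; $h_f(m):=(1+4N)\big(16(k+1)^2(f(\sigma_1(\tilde k,g(m)))+1)+1\big)-1$; $\Delta:=\Psi(32(k+1)^2-1,\,h_f)$, where for $k'\in\mathbb{N}$ and monotone $u:\mathbb{N}\to\mathbb{N}$, $\Psi(k',u):=\chi_1\big(24N(w_{\hat\nu_u,N}^{(R)}(0)+1)^2\big)$ with $R:=4N^4(k'+1)^2$, $\nu_u(m):=\max\{2,{\rm b}(u(m))\}(u(m)+1)-1$, $\hat\nu_u(m):=\nu_u(\chi_1(m))$,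 $w_{v,N}(m):=\max\{v(24N(m+1)^2),24N(m+1)^2\}$, $\xi(k''):=\max\{{\rm a}(2(2\mathcal{D}+\mathcal{E})(k''+1)-1),{\rm E}(2k''+1)+1\}$ and $\chi_1(k''):=\max\{\xi(4k''+3),{\rm B}(8(\mathcal{D}+\mathcal{E})(k''+1)-1)\}+1$.
   Context: $X$ is a real Hilbert space, $\mathsf{A}:X\to 2^X$ a maximal monotone operator with zero set $S=\{x:0\in\mathsf{A}(x)\}$, assumed nonempty. For $\beta>0$, $J_\beta:=(Id+\beta\mathsf{A})^{-1}$ is the resolvent, a single-valued nonexpansive map with fixed point set $S$. Given $(\alpha_n)\subset\,]0,1[$, $(\beta_n)\subset(0,\infty)$, $(e_n)\subset X$, $x_0\in X$, (HPPA) is the sequence $x_{n+1}:=\alpha_n x_0+(1-\alpha_n)(J_{\beta_n}(x_n)+e_n)$. (Q1): $\forall k\,\forall n\geq{\rm a}(k)\ \alpha_n\leq\frac{1}{k+1}$. (Q2): $\forall k\ \sum_{i=0}^{{\rm A}(k)}\alpha_i\geq k$. (Q3'): $\forall n\ \beta_n\leq{\rm b}(n)$. (Q3): $\forall k\,\forall n\geq{\rm B}(k)\ \beta_n\geq k$. (Q4): $\forall k\,\forall n\ \sum_{i={\rm E}(k)+1}^{{\rm E}(k)+n}\|e_i\|\leq\frac{1}{k+1}$. Monotone means nondecreasing. $v^{(R)}$ is the $R$-fold composition of $v$ ($v^{(0)}$ the identity). $[a,b]$ is the set of naturals $m$ with $a\le m\le b$. *)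

theory Defs
  imports "HOL-Analysis.Analysis"
begin

definition monotone_op :: "('x::real_inner \<Rightarrow> 'x set) \<Rightarrow> bool" where
  "monotone_op T \<longleftrightarrow>
     (\<forall>x y u v. u \<in> T x \<longrightarrow> v \<in> T y \<longrightarrow> inner (x - y) (u - v) \<ge> 0)"

definition maximal_monotone :: "('x::real_inner \<Rightarrow> 'x set) \<Rightarrow> bool" where
  "maximal_monotone T \<longleftrightarrow> monotone_op T \<and>
     (\<forall>T'. monotone_op T' \<and> (\<forall>x. T x \<subseteq> T' x) \<longrightarrow> T' = T)"

definition zeros :: "('x::real_inner \<Rightarrow> 'x set) \<Rightarrow> 'x set" where
  "zeros T = {x. 0 \<in> T x}"

text \<open>Resolvent J_beta = (Id + beta T)^{-1}: J_beta(x) is the (unique, for maximal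
  monotone T and beta > 0) y with x \<in> y + beta T(y).\<close>
definition resolvent :: "('x::real_inner \<Rightarrow> 'x set) \<Rightarrow> real \<Rightarrow> 'x \<Rightarrow> 'x" where
  "resolvent T \<beta> x = (THE y. \<exists>u \<in> T y. x = y + \<beta> *\<^sub>R u)"

definition sigma1 :: "(nat \<Rightarrow> nat) \<Rightarrow> nat \<Rightarrow> nat \<Rightarrow> nat \<Rightarrow> nat" where
  "sigma1 A N k' n' = A (n' + nat \<lceil>ln (real (16 * N^2 * (k' + 1)))\<rceil>) + 1"

definition xi :: "(nat \<Rightarrow> nat) \<Rightarrow> (nat \<Rightarrow> nat) \<Rightarrow> nat \<Rightarrow> nat \<Rightarrow> nat \<Rightarrow> nat" where
  "xi a E D Ec k'' = max (a (2 * (2 * D + Ec) * (k'' + 1) - 1)) (E (2 * k'' + 1) + 1)"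

definition chi1 :: "(nat \<Rightarrow> nat) \<Rightarrow> (nat \<Rightarrow> nat) \<Rightarrow> (nat \<Rightarrow> nat) \<Rightarrow> nat \<Rightarrow> nat \<Rightarrow> nat \<Rightarrow> nat" where
  "chi1 a B E D Ec k'' = max (xi a E D Ec (4 * k'' + 3)) (B (8 * (D + Ec) * (k'' + 1) - 1)) + 1"

definition nu :: "(nat \<Rightarrow> nat) \<Rightarrow> (nat \<Rightarrow> nat) \<Rightarrow> nat \<Rightarrow> nat" where
  "nu b u m = max 2 (b (u m)) * (u m + 1) - 1"

definition wfun :: "(nat \<Rightarrow> nat) \<Rightarrow> nat \<Rightarrow> nat \<Rightarrow> nat" where
  "wfun v N m = max (v (24 * N * (m + 1)^2)) (24 * N * (m + 1)^2)"

definition Psi :: "(nat \<Rightarrow> nat) \<Rightarrow> (nat \<Rightarrow> nat) \<Rightarrow> (nat \<Rightarrow> nat) \<Rightarrow> (nat \<Rightarrow> nat)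
    \<Rightarrow> nat \<Rightarrow> nat \<Rightarrow> nat \<Rightarrow> nat \<Rightarrow> (nat \<Rightarrow> nat) \<Rightarrow> nat" where
  "Psi a b B E D Ec N k' u =
     (let R = 4 * N^4 * (k' + 1)^2;
          nuhat = (\<lambda>m. nu b u (chi1 a B E D Ec m))
      in chi1 a B E D Ec (24 * N * (((wfun nuhat N) ^^ R) 0 + 1)^2))"

definition Phi1 :: "(nat \<Rightarrow> nat) \<Rightarrow> (nat \<Rightarrow> nat) \<Rightarrow> (nat \<Rightarrow> nat) \<Rightarrow> (nat \<Rightarrow> nat) \<Rightarrow> (nat \<Rightarrow> nat)
    \<Rightarrow> nat \<Rightarrow> nat \<Rightarrow> nat \<Rightarrow> nat \<Rightarrow> (nat \<Rightarrow> nat) \<Rightarrow> nat" where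
  "Phi1 a A b B E D Ec N k f =
     (let kt = 4 * (k + 1)^2 - 1;
          g = (\<lambda>m. max m (E (16 * (1 + 4 * N) * (k + 1)^2 - 1) + 1));
          h = (\<lambda>m. (1 + 4 * N) * (16 * (k + 1)^2 * (f (sigma1 A N kt (g m)) + 1) + 1) - 1);
          \<Delta> = Psi a b B E D Ec N (32 * (k + 1)^2 - 1) h
      in sigma1 A N kt (g \<Delta>))"

end

(* A resolvent is everywhere defined by Minty's theorem: the points y with <v - y, u + y> >= 0 form a
   closed ball, finitely many such balls have a common point (maximise a strictly concave function over
   a compact convex hull), and bounded closed convex sets in a Hilbert space enjoy the finite
   intersection property.

   Quantitatively, x_n is an approximate fixed point of J_1 with rate chi1. Minimising |x_0 - y|
   approximately over approximate fixed points y of J_1, by at most R successive improvements starting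
   from p, produces z and n such that <x_0 - z, x_j - z> is small for all j >= n while z is as good an
   approximate fixed point of the J_{beta_i}, i <= u(n), as the counterfunction u requires. The Halpern
   recursion for |x_i - z|^2 then brings x_i within 1/(2(k+1)) of z on the whole interval [n, f(n)]. *)
theory Submission
  imports Defs
begin

section \<open>Minty's theorem by intersecting balls\<close>

section \<open>Minty points\<close>

text \<open>Monotonicity is put on sets of pairs (point, value) so that it passes to finite subsets
  and also covers shifted graphs such as (v, \<beta>u - x).\<close>

definition monotone_graph :: "('x::real_inner \<times> 'x) set \<Rightarrow> bool" where
  "monotone_graph G \<longleftrightarrow> (\<forall>(v, u)\<in>G. \<forall>(v', u')\<in>G. 0 \<le> inner (v - v') (u - u'))"

text \<open>Twice the difference of the two sides is the double sum of c_i c_j <v_i - v_j, u_i -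
  u_j>, whose terms are nonnegative.\<close>

lemma inner_convex_combination_le:
  fixes v u :: "'i \<Rightarrow> 'x::real_inner"
  assumes "finite I" and nn: "\<And>i. i \<in> I \<Longrightarrow> 0 \<le> c i" and c1: "sum c I = 1"
    and mono: "\<And>i j. i \<in> I \<Longrightarrow> j \<in> I \<Longrightarrow> 0 \<le> inner (v i - v j) (u i - u j)"
  shows "inner (\<Sum>i\<in>I. c i *\<^sub>R v i) (\<Sum>i\<in>I. c i *\<^sub>R u i) \<le> (\<Sum>i\<in>I. c i * inner (v i) (u i))"
proof -
  let ?A = "\<Sum>i\<in>I. c i * inner (v i) (u i)"
  let ?P = "inner (\<Sum>i\<in>I. c i *\<^sub>R v i) (\<Sum>i\<in>I. c i *\<^sub>R u i)"
  have P': "?P = (\<Sum>i\<in>I. \<Sum>j\<in>I. c i * c j * inner (v j) (u i))"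
    by (simp add: inner_sum_left inner_sum_right sum_distrib_left mult_ac)
  have P: "?P = (\<Sum>i\<in>I. \<Sum>j\<in>I. c i * c j * inner (v i) (u j))"
    unfolding P' by (subst sum.swap) (simp add: mult_ac)
  have A1: "?A = (\<Sum>i\<in>I. \<Sum>j\<in>I. c i * c j * inner (v i) (u i))"
    using c1 by (simp add: sum_distrib_left[symmetric] sum_distrib_right[symmetric] mult_ac)
  have A2: "?A = (\<Sum>i\<in>I. \<Sum>j\<in>I. c i * c j * inner (v j) (u j))"
    unfolding A1 by (subst sum.swap) (simp add: mult_ac)
  have "0 \<le> (\<Sum>i\<in>I. \<Sum>j\<in>I. c i * c j * inner (v i - v j) (u i - u j))"
    by (intro sum_nonneg mult_nonneg_nonneg nn mono)
  also have "\<dots> = (\<Sum>i\<in>I. \<Sum>j\<in>I. c i * c j * inner (v i) (u i)) + (\<Sum>i\<in>I. \<Sum>j\<in>I. c i * c j * inner (v j) (u j))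
      - (\<Sum>i\<in>I. \<Sum>j\<in>I. c i * c j * inner (v i) (u j)) - (\<Sum>i\<in>I. \<Sum>j\<in>I. c i * c j * inner (v j) (u i))"
    by (simp add: sum.distrib[symmetric] sum_subtractf[symmetric] algebra_simps inner_diff_left inner_diff_right)
  also have "\<dots> = 2 * (?A - ?P)"
    by (simp only: P[symmetric] P'[symmetric] A1[symmetric] A2[symmetric]) simp
  finally show ?thesis by simp
qed

text \<open>A finite-dimensional duality argument: the maximal dual value is at most 0 by
  monotonicity, and first-order optimality of the maximiser then yields every single
  inequality.\<close>

lemma minty_point_finite:
  fixes G :: "('x::real_inner \<times> 'x) set"
  assumes fin: "finite G" and "G \<noteq> {}" and mono: "monotone_graph G"
  shows "\<exists>y. \<forall>(v, u)\<in>G. 0 \<le> inner (v - y) (u + y)"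
proof -
  \<comment> \<open>With c = (v - u)/2, the condition <v - y, u + y> >= 0 reads |y|^2 - 2<c, y> -
    <v, u> <= 0, so only c and -<v, u> matter. Minimising a convex combination of these left sides
    over y leaves the dual function s - |c|^2, which is \<open>\<Psi>\<close>.\<close>
  define q :: "'x \<times> 'x \<Rightarrow> 'x \<times> real"
    where "q = (\<lambda>(v, u). ((1/2) *\<^sub>R (v - u), - inner v u))"
  define \<Psi> :: "'x \<times> real \<Rightarrow> real" where "\<Psi> = (\<lambda>(y, s). s - inner y y)"
  let ?H = "convex hull (q ` G)"
  have cpt: "compact ?H" using fin by (simp add: finite_imp_compact_convex_hull)
  have ne: "?H \<noteq> {}" using \<open>G \<noteq> {}\<close> by simp
  have "continuous_on ?H \<Psi>"
    unfolding \<Psi>_def case_prod_unfold by (intro continuous_intros)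
  then obtain h where h: "h \<in> ?H" and hmax: "\<And>z. z \<in> ?H \<Longrightarrow> \<Psi> z \<le> \<Psi> h"
    using continuous_attains_sup[OF cpt ne] by blast
  obtain y s where ys: "h = (y, s)" by force
  \<comment> \<open>With V and U the weighted means of the points and of the values, monotonicity
    gives s <= -<V, U>, while |y|^2 + <V, U> = |(V + U)/2|^2 >= 0.\<close>
  have neg: "\<Psi> h \<le> 0"
  proof -
    \<comment> \<open>\<open>q\<close> need not be injective, so the weights live on its image and
      \<open>r\<close> chooses one pair of \<open>G\<close> for each image point.\<close>
    define r where "r = inv_into G q"
    have r: "r z \<in> G" "q (r z) = z" if "z \<in> q ` G" for z
      using that by (auto simp: r_def inv_into_into f_inv_into_f)
    let ?I = "q ` G"
    obtain c where c: "\<And>z. z \<in> ?I \<Longrightarrow> 0 \<le> c z" "sum c ?I = 1" "(\<Sum>z\<in>?I. c z *\<^sub>R z) = h"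
      using h unfolding convex_hull_finite[OF finite_imageI[OF fin]] by blast
    let ?V = "\<Sum>z\<in>?I. c z *\<^sub>R fst (r z)" and ?U = "\<Sum>z\<in>?I. c z *\<^sub>R snd (r z)"
    have hq: "h = (\<Sum>z\<in>?I. c z *\<^sub>R q (r z))"
      unfolding c(3)[symmetric] by (rule sum.cong) (simp_all add: r)
    have y: "y = (1/2) *\<^sub>R (?V - ?U)"
    proof -
      have "y = fst h" using ys by simp
      also have "\<dots> = (\<Sum>z\<in>?I. c z *\<^sub>R ((1/2) *\<^sub>R (fst (r z) - snd (r z))))"
        unfolding hq by (simp add: fst_sum q_def case_prod_unfold)
      finally show ?thesis
        by (simp add: scaleR_sum_right sum_subtractf[symmetric] algebra_simps)
    qed
    have s: "s = - (\<Sum>z\<in>?I. c z * inner (fst (r z)) (snd (r z)))"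
    proof -
      have "s = snd h" using ys by simp
      also have "\<dots> = (\<Sum>z\<in>?I. c z * (- inner (fst (r z)) (snd (r z))))"
        unfolding hq by (simp add: snd_sum q_def case_prod_unfold)
      finally show ?thesis by (simp add: sum_negf)
    qed
    have "inner ?V ?U \<le> - s"
      unfolding s minus_minus
    proof (rule inner_convex_combination_le[OF finite_imageI[OF fin] c(1,2)])
      fix z z' assume "z \<in> ?I" "z' \<in> ?I"
      then have "r z \<in> G" "r z' \<in> G" by (auto intro: r(1))
      then show "0 \<le> inner (fst (r z) - fst (r z')) (snd (r z) - snd (r z'))"
        using mono unfolding monotone_graph_def case_prod_unfold by blast
    qed
    moreover have "inner y y + inner ?V ?U = inner ((1/2) *\<^sub>R (?V + ?U)) ((1/2) *\<^sub>R (?V + ?U))"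
      unfolding y by (simp add: inner_diff_left inner_diff_right inner_add_left inner_add_right algebra_simps inner_commute)
    moreover have "0 \<le> inner ((1/2) *\<^sub>R (?V + ?U)) ((1/2) *\<^sub>R (?V + ?U))" by (rule inner_ge_zero)
    ultimately show ?thesis unfolding ys \<Psi>_def by (simp del: inner_ge_zero)
  qed
  have "0 \<le> inner (v - y) (u + y)" if vu: "(v, u) \<in> G" for v u
  proof -
    let ?c = "(1/2) *\<^sub>R (v - u)"
    let ?X = "inner (?c - y) (?c - y)" and ?r = "inner ?c ?c + inner v u"
    \<comment> \<open>first-order optimality of the maximiser h in the direction of the vertex given by (v, u)\<close>
    have step: "(1 - t) * ?X \<le> ?r" if t: "0 < t" "t < 1" for t
    proof -
      have "(1 - t) *\<^sub>R h + t *\<^sub>R q (v, u) \<in> ?H"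
        using t h vu by (intro convexD convex_convex_hull) (auto intro: hull_inc)
      from hmax[OF this]
      have "(1 - t) * s - t * inner v u - inner ((1 - t) *\<^sub>R y + t *\<^sub>R ?c) ((1 - t) *\<^sub>R y + t *\<^sub>R ?c) \<le> s - inner y y"
        by (simp add: ys \<Psi>_def q_def)
      moreover have "inner ((1 - t) *\<^sub>R y + t *\<^sub>R ?c) ((1 - t) *\<^sub>R y + t *\<^sub>R ?c)
          = (1 - t) * inner y y + t * inner ?c ?c - t * (1 - t) * ?X"
        by (simp only: inner_diff_left inner_diff_right inner_add_left inner_add_right inner_scaleR_left inner_scaleR_right
            inner_commute[of "?c" y]) (simp add: field_simps)
        ultimately have "t * ((1 - t) * ?X) \<le> t * (?r + (s - inner y y))"
        by (simp add: algebra_simps)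
      then have "(1 - t) * ?X \<le> ?r + (s - inner y y)" using t by (simp add: mult_le_cancel_left)
      then show ?thesis using neg by (simp add: ys \<Psi>_def)
    qed
    have "((\<lambda>t. (1 - t) * ?X) \<longlongrightarrow> (1 - 0) * ?X) (at_right (0::real))"
      by (intro tendsto_intros)
    moreover have "eventually (\<lambda>t. (1 - t) * ?X \<le> ?r) (at_right (0::real))"
      using step by (auto simp: eventually_at_right_field intro!: exI[of _ 1])
    ultimately have "(1 - 0) * ?X \<le> ?r"
      by (rule tendsto_upperbound) simp
    moreover have "?r - ?X = inner (v - y) (u + y)"
      by (simp add: inner_diff_left inner_diff_right inner_add_left inner_add_right algebra_simps inner_commute)
    ultimately show ?thesis by simp
  qed
  then show ?thesis by blast
qed

text \<open>Take finite subfamilies whose distance from the origin approaches the supremum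
  \<open>s\<close>. Points of nearly minimal norm in them are Cauchy by the parallelogram law, and
  adding any further member of the family does not move the limit.\<close>

lemma centered_closed_convex_Inter_nonempty:
  fixes F :: "'x::{real_inner, complete_space} set set"
  assumes closed: "\<And>A. A \<in> F \<Longrightarrow> closed A" and convex: "\<And>A. A \<in> F \<Longrightarrow> convex A"
    and B: "B \<in> F" "bounded B"
    and fip: "\<And>I. finite I \<Longrightarrow> I \<subseteq> F \<Longrightarrow> \<Inter>I \<noteq> {}"
  shows "\<Inter>F \<noteq> {}"
proof -
  \<comment> \<open>The bounded set is put into every intersection, which keeps the minimal norms
    bounded and hence \<open>s\<close> finite.\<close>
  define K where "K I = \<Inter>(insert B I)" for I
  define d where "d I = Inf ((\<lambda>y. (norm y)\<^sup>2) ` K I)" for I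
  let ?\<F> = "{I. finite I \<and> I \<subseteq> F}"
  have Kne: "K I \<noteq> {}" if "I \<in> ?\<F>" for I
    using fip[of "insert B I"] that B(1) by (auto simp: K_def)
  have Kconv: "convex (K I)" if "I \<in> ?\<F>" for I
    unfolding K_def using that B(1) convex by (intro convex_Inter) auto
  obtain M where M: "\<And>y. y \<in> B \<Longrightarrow> norm y \<le> M" using B(2) by (auto simp: bounded_iff)
  have d_le: "d I \<le> (norm y)\<^sup>2" if "y \<in> K I" for I y
    unfolding d_def using that by (intro cINF_lower bdd_belowI2[where m=0]) auto
  have d_bdd: "d I \<le> M\<^sup>2" if I: "I \<in> ?\<F>" for I
  proof -
    obtain y where y: "y \<in> K I" using Kne[OF I] by blast
    then have "norm y \<le> M" using M by (simp add: K_def)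
    then show ?thesis using d_le[OF y] power_mono[of "norm y" M 2] by simp
  qed
  define s where "s = Sup (d ` ?\<F>)"
  have bdd: "bdd_above (d ` ?\<F>)" using d_bdd by (intro bdd_aboveI2) 
  have d_le_s: "d I \<le> s" if "I \<in> ?\<F>" for I
    unfolding s_def using that bdd by (intro cSUP_upper)
  have "\<exists>I\<in>?\<F>. s - 1 / real (Suc n) < d I" for n
  proof -
    have "d ` ?\<F> \<noteq> {}" by auto
    from less_cSupD[OF this, of "s - 1 / real (Suc n)"] show ?thesis
      by (auto simp: s_def)
  qed
  then obtain I where I: "\<And>n. I n \<in> ?\<F>" "\<And>n. s - 1 / real (Suc n) < d (I n)" by metis
  \<comment> \<open>Taking unions makes the sets \<open>K (J n)\<close> decreasing, so that later
    near-minimisers remain admissible for earlier indices.\<close>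
  define J where "J n = (\<Union>i\<le>n. I i)" for n
  have J: "J n \<in> ?\<F>" for n using I(1) by (auto simp: J_def)
  have KJ: "K (J m) \<subseteq> K (I n)" if "n \<le> m" for m n
    using that by (auto simp: K_def J_def)
  have near: "\<exists>y\<in>K L. (norm y)\<^sup>2 < s + 1 / real (Suc n)" if L: "L \<in> ?\<F>" for L n
  proof -
    have "d L < s + 1 / real (Suc n)" using d_le_s[OF L] 
      by (smt (verit) of_nat_0_less_iff zero_less_Suc zero_less_divide_1_iff)
    then show ?thesis
      using cInf_lessD[of "(\<lambda>y. (norm y)\<^sup>2) ` K L"] Kne[OF L] by (auto simp: d_def)
  qed
  \<comment> \<open>The midpoint has squared norm above s - 1/(n+1), both ends have it below s +
    1/(n+1); the parallelogram law adds these gaps up to 8/(n+1).\<close>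
  have close: "(norm (z - z'))\<^sup>2 < 8 / real (Suc n)"
    if z: "z \<in> K (I n)" "z' \<in> K (I n)" "(norm z)\<^sup>2 < s + 1 / real (Suc n)" "(norm z')\<^sup>2 < s + 1 / real (Suc n)"
    for z z' n
  proof -
    have "(1/2) *\<^sub>R z + (1/2) *\<^sub>R z' \<in> K (I n)"
      using Kconv[OF I(1)] z by (intro convexD) auto
    then have "s - 1 / real (Suc n) < (norm ((1/2) *\<^sub>R z + (1/2) *\<^sub>R z'))\<^sup>2"
      using d_le I(2)[of n] by (meson less_le_trans)
    moreover have "(norm (z - z'))\<^sup>2 = 2 * (norm z)\<^sup>2 + 2 * (norm z')\<^sup>2 - 4 * (norm ((1/2) *\<^sub>R z + (1/2) *\<^sub>R z'))\<^sup>2"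
      by (simp add: power2_norm_eq_inner inner_diff_left inner_diff_right inner_add_left inner_add_right 
          inner_commute algebra_simps)
    ultimately have "(norm (z - z'))\<^sup>2 < 8 * (1 / real (Suc n))" using z(3,4) by linarith
    then show ?thesis by simp
  qed
  have antimono: "1 / real (Suc m) \<le> 1 / real (Suc n)" if "n \<le> m" for m n
    using that by (simp add: field_simps)
  have "\<forall>n. \<exists>y. y \<in> K (J n) \<and> (norm y)\<^sup>2 < s + 1 / real (Suc n)" using near[OF J] by blast
  from choice[OF this] obtain y where y: "\<And>n. y n \<in> K (J n)" "\<And>n. (norm (y n))\<^sup>2 < s + 1 / real (Suc n)"
    by blast
  have to0: "(\<lambda>n. sqrt (8 / real (Suc n))) \<longlonglongrightarrow> 0"
    by real_asymp
  have "Cauchy y"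
  proof (rule metric_CauchyI)
    fix \<epsilon> :: real assume "0 < \<epsilon>"
    then have "\<forall>\<^sub>F n in sequentially. sqrt (8 / real (Suc n)) < \<epsilon>"
      by (rule order_tendstoD(2)[OF to0])
    then obtain n where n: "sqrt (8 / real (Suc n)) < \<epsilon>"
      unfolding eventually_sequentially by blast
    have *: "y m \<in> K (I n)" "(norm (y m))\<^sup>2 < s + 1 / real (Suc n)" if "n \<le> m" for m
      subgoal using y(1)[of m] KJ[OF that] by blast
      subgoal using y(2)[of m] antimono[OF that] by linarith
      done
    have "dist (y m) (y m') < \<epsilon>" if "n \<le> m" "n \<le> m'" for m m'
    proof -
      have "norm (y m - y m') < sqrt (8 / real (Suc n))"
        by (intro real_less_rsqrt close * that)
      then show ?thesis using n by (simp add: dist_norm)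
    qed
    then show "\<exists>M. \<forall>m\<ge>M. \<forall>n\<ge>M. dist (y m) (y n) < \<epsilon>" by blast
  qed
  then obtain l where l: "y \<longlonglongrightarrow> l" using Cauchy_convergent convergentD by blast
  have "l \<in> A" if A: "A \<in> F" for A
  proof -
    \<comment> \<open>Near-minimisers that also lie in A are compared with \<open>y n\<close> inside
      the common set \<open>K (I n)\<close>; they share its limit, which is therefore in the closed
      set A.\<close>
    have "insert A (J n) \<in> ?\<F>" for n using J A by auto
    then have "\<forall>n. \<exists>y. y \<in> K (insert A (J n)) \<and> (norm y)\<^sup>2 < s + 1 / real (Suc n)" using near by blast
    from choice[OF this] obtain y' where y': "\<And>n. y' n \<in> K (insert A (J n))" "\<And>n. (norm (y' n))\<^sup>2 < s + 1 / real (Suc n)"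
      by blast
    have "norm (y' n - y n) \<le> sqrt (8 / real (Suc n))" for n
    proof -
      have "y' n \<in> K (I n)" "y n \<in> K (I n)" using y'(1)[of n] y(1)[of n] KJ[of n n] by (auto simp: K_def)
      then show ?thesis using close[of "y' n" n "y n"] y'(2) y(2) by (intro real_le_rsqrt) (auto intro: less_imp_le)
    qed
    then have "(\<lambda>n. y' n - y n) \<longlonglongrightarrow> 0"
      by (intro Lim_null_comparison[OF _ to0] always_eventually) auto
    from tendsto_add[OF this l] have "y' \<longlonglongrightarrow> l" by simp
    moreover have "y' n \<in> A" for n using y'(1)[of n] by (auto simp: K_def)
    ultimately show ?thesis using closed_sequentially[OF closed[OF A]] by blast
  qed
  then show ?thesis by blast
qed

text \<open>Polarisation: the inner product equals squared radius minus squared distance to the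
  centre.\<close>

lemma inner_nonneg_iff_cball:
  fixes v u y :: "'x::real_inner"
  shows "0 \<le> inner (v - y) (u + y) \<longleftrightarrow> y \<in> cball ((1/2) *\<^sub>R (v - u)) (norm ((1/2) *\<^sub>R (v + u)))"
proof -
  have "(norm ((1/2) *\<^sub>R (v + u)))\<^sup>2 - (norm ((1/2) *\<^sub>R (v - u) - y))\<^sup>2 = inner (v - y) (u + y)"
    by (simp add: power2_norm_eq_inner inner_diff_left inner_diff_right inner_add_left inner_add_right 
        inner_commute algebra_simps del: norm_scaleR)
  then show ?thesis
    by (metis abs_norm_cancel diff_ge_0_iff_ge dist_norm mem_cball abs_le_square_iff)
qed

lemma minty_point:
  fixes G :: "('x::{real_inner, complete_space} \<times> 'x) set"
  assumes mono: "monotone_graph G"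
  shows "\<exists>y. \<forall>(v, u)\<in>G. 0 \<le> inner (v - y) (u + y)"
proof (cases "G = {}")
  case False
  define C :: "'x \<times> 'x \<Rightarrow> 'x set"
    where "C = (\<lambda>(v, u). cball ((1/2) *\<^sub>R (v - u)) (norm ((1/2) *\<^sub>R (v + u))))"
  have C: "y \<in> C g \<longleftrightarrow> 0 \<le> inner (fst g - y) (snd g + y)" for y g
    unfolding C_def case_prod_unfold by (rule inner_nonneg_iff_cball[symmetric])
  obtain g0 where g0: "g0 \<in> G" using False by blast
  have "\<Inter>(C ` G) \<noteq> {}"
  proof (rule centered_closed_convex_Inter_nonempty)
    show "C g0 \<in> C ` G" using g0 by blast
    fix I assume "finite I" "I \<subseteq> C ` G"
    then obtain H where H: "H \<subseteq> G" "finite H" "I = C ` H" by (meson finite_subset_image)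
    show "\<Inter>I \<noteq> {}"
    proof (cases "H = {}")
      case False
      have "monotone_graph H" using mono H(1) unfolding monotone_graph_def by blast
      from minty_point_finite[OF H(2) False this] show ?thesis
        unfolding H(3) using C by (fastforce simp: case_prod_unfold)
    qed (simp add: H(3))
  qed (auto simp: C_def case_prod_unfold)
  then show ?thesis using C by (fastforce simp: case_prod_unfold)
qed simp

section \<open>Surjectivity of Id + \<beta>T and estimates for displacements\<close>

section \<open>Resolvents\<close>

text \<open>Maximality enters here: adjoining the pair (y, w) to the graph keeps it monotone, so the
  pair was already there.\<close>

lemma maximal_monotone_mem:
  assumes T: "maximal_monotone T" and y: "\<And>v u. u \<in> T v \<Longrightarrow> 0 \<le> inner (v - y) (u - w)"
  shows "w \<in> T y"
proof -
  let ?T' = "T(y := insert w (T y))"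
  have mono: "0 \<le> inner (a - b) (u - v)" if "u \<in> T a" "v \<in> T b" for a b u v
    using T that by (auto simp: maximal_monotone_def monotone_op_def)
  have y': "0 \<le> inner (y - v) (w - u)" if "u \<in> T v" for v u
    using y[OF that] by (metis inner_minus_left inner_minus_right minus_diff_eq minus_minus)
  have "monotone_op ?T'"
    unfolding monotone_op_def using y y' mono by (auto split: if_splits)
  moreover have "\<forall>x. T x \<subseteq> ?T' x" by auto
  ultimately have "?T' = T" using T unfolding maximal_monotone_def by blast
  then show ?thesis by (metis fun_upd_same insertI1)
qed

text \<open>A Minty point y of the shifted graph (v, \<beta>u - x) makes (x - y)/\<beta>
  monotonically related to all of the graph of \<open>T\<close>, hence a value at y.\<close>

lemma resolvent_ex:
  fixes T :: "'x::{real_inner, complete_space} \<Rightarrow> 'x set"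
  assumes T: "maximal_monotone T" and "0 < \<beta>"
  shows "\<exists>y. \<exists>u\<in>T y. x = y + \<beta> *\<^sub>R u"
proof -
  let ?G = "{(v, \<beta> *\<^sub>R u - x) | v u. u \<in> T v}"
  have "monotone_graph ?G"
    using T \<open>0 < \<beta>\<close>
    by (auto simp: monotone_graph_def maximal_monotone_def monotone_op_def simp flip: scaleR_diff_right)
  then obtain y where y: "\<forall>(v, u)\<in>?G. 0 \<le> inner (v - y) (u + y)" using minty_point by blast
  have "(1 / \<beta>) *\<^sub>R (x - y) \<in> T y"
  proof (rule maximal_monotone_mem[OF T])
    fix v u assume "u \<in> T v"
    then have "0 \<le> inner (v - y) (\<beta> *\<^sub>R u - x + y)" using y by blast
    also have "\<beta> *\<^sub>R u - x + y = \<beta> *\<^sub>R (u - (1 / \<beta>) *\<^sub>R (x - y))"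
      using \<open>0 < \<beta>\<close> by (simp add: algebra_simps)
    finally show "0 \<le> inner (v - y) (u - (1 / \<beta>) *\<^sub>R (x - y))"
      using \<open>0 < \<beta>\<close> by (simp add: zero_le_mult_iff)
  qed
  moreover have "x = y + \<beta> *\<^sub>R ((1 / \<beta>) *\<^sub>R (x - y))" using \<open>0 < \<beta>\<close> by simp
  ultimately show ?thesis by blast
qed

text \<open>Monotonicity gives |y - z|^2 <= <y - z, d> for the difference d of the shifted points;
  Cauchy-Schwarz does the rest.\<close>

lemma resolvent_step_nonexpansive:
  assumes T: "monotone_op T" and "0 < \<beta>" and uv: "u \<in> T y" "v \<in> T z"
  shows "norm (y - z) \<le> norm ((y + \<beta> *\<^sub>R u) - (z + \<beta> *\<^sub>R v))"
proof -
  let ?d = "(y + \<beta> *\<^sub>R u) - (z + \<beta> *\<^sub>R v)"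
  have "0 \<le> \<beta> * inner (y - z) (u - v)" using assms by (simp add: monotone_op_def)
  then have "(norm (y - z))\<^sup>2 \<le> inner (y - z) ?d"
    by (simp add: power2_norm_eq_inner algebra_simps inner_diff_left inner_diff_right inner_add_right)
  also have "\<dots> \<le> norm (y - z) * norm ?d" by (rule norm_cauchy_schwarz)
  finally show ?thesis
    by (cases "norm (y - z) = 0") (auto simp: power2_eq_square)
qed

lemma resolvent_eqI:
  assumes T: "monotone_op T" and "0 < \<beta>" and u: "u \<in> T y"
  shows "resolvent T \<beta> (y + \<beta> *\<^sub>R u) = y"
  unfolding resolvent_def
proof (rule the_equality)
  show "\<exists>u'\<in>T y. y + \<beta> *\<^sub>R u = y + \<beta> *\<^sub>R u'" using u by blast
  fix z assume "\<exists>v\<in>T z. y + \<beta> *\<^sub>R u = z + \<beta> *\<^sub>R v"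
  then show "z = y" using resolvent_step_nonexpansive[OF T \<open>0 < \<beta>\<close> u] by force
qed

text \<open>Existence and uniqueness together justify the definite description in
  \<open>resolvent\<close>; later arguments use only this decomposition.\<close>

lemma resolvent_cases:
  fixes T :: "'x::{real_inner, complete_space} \<Rightarrow> 'x set"
  assumes T: "maximal_monotone T" and "0 < \<beta>"
  obtains u where "u \<in> T (resolvent T \<beta> x)" "x = resolvent T \<beta> x + \<beta> *\<^sub>R u"
proof -
  have mono: "monotone_op T" using T by (simp add: maximal_monotone_def)
  obtain y u where "u \<in> T y" "x = y + \<beta> *\<^sub>R u" using resolvent_ex[OF assms] by blast
  with resolvent_eqI[OF mono \<open>0 < \<beta>\<close> this(1)] that show thesis by metis
qed

context
  fixes T :: "'x::{real_inner, complete_space} \<Rightarrow> 'x set"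
  assumes T: "maximal_monotone T"
begin

private lemma mono: "monotone_op T"
  using T by (simp add: maximal_monotone_def)

lemma resolvent_nonexpansive:
  assumes "0 < \<beta>"
  shows "norm (resolvent T \<beta> x - resolvent T \<beta> y) \<le> norm (x - y)"
  by (metis assms T mono resolvent_cases resolvent_step_nonexpansive)

lemma resolvent_zero:
  assumes "0 < \<beta>" "p \<in> zeros T"
  shows "resolvent T \<beta> p = p"
  using resolvent_eqI[OF mono \<open>0 < \<beta>\<close>, of 0 p] assms by (simp add: zeros_def)

lemma resolvent_displacement_le:
  assumes "0 < \<beta>" and u: "u \<in> T y"
  shows "norm (y - resolvent T \<beta> y) \<le> \<beta> * norm u"
proof -
  have "norm (y - resolvent T \<beta> y) = norm (resolvent T \<beta> (y + \<beta> *\<^sub>R u) - resolvent T \<beta> y)"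
    using resolvent_eqI[OF mono assms] by simp
  also have "\<dots> \<le> norm (y + \<beta> *\<^sub>R u - y)" by (rule resolvent_nonexpansive[OF \<open>0 < \<beta>\<close>])
  finally show ?thesis using \<open>0 < \<beta>\<close> by simp
qed

text \<open>Write the displacements as \<mu>u and \<kappa>v. Monotonicity at the two resolvent
  points and Cauchy-Schwarz give (|u| - |v|)(\<mu>|u| - \<kappa>|v|) <= 0, and \<mu> <= \<kappa>
  then decides both signs.\<close>

lemma resolvent_displacement_mono:
  assumes "0 < \<mu>" "\<mu> \<le> \<kappa>"
  shows "norm (x - resolvent T \<mu> x) \<le> norm (x - resolvent T \<kappa> x)"
    and "\<mu> * norm (x - resolvent T \<kappa> x) \<le> \<kappa> * norm (x - resolvent T \<mu> x)"
proof -
  have "0 < \<kappa>" using assms by simp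
  obtain u where u: "u \<in> T (resolvent T \<mu> x)" "x = resolvent T \<mu> x + \<mu> *\<^sub>R u"
    using resolvent_cases[OF T \<open>0 < \<mu>\<close>] .
  obtain v where v: "v \<in> T (resolvent T \<kappa> x)" "x = resolvent T \<kappa> x + \<kappa> *\<^sub>R v"
    using resolvent_cases[OF T \<open>0 < \<kappa>\<close>] .
  have pu: "x - resolvent T \<mu> x = \<mu> *\<^sub>R u" and qv: "x - resolvent T \<kappa> x = \<kappa> *\<^sub>R v"
    using u(2) v(2) by (metis add_diff_cancel_left')+
  have "resolvent T \<mu> x - resolvent T \<kappa> x = \<kappa> *\<^sub>R v - \<mu> *\<^sub>R u"
    unfolding pu[symmetric] qv[symmetric] by simp
  then have "0 \<le> inner (\<kappa> *\<^sub>R v - \<mu> *\<^sub>R u) (u - v)"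
    using mono u(1) v(1) by (metis monotone_op_def)
  then have "\<mu> * (norm u)\<^sup>2 + \<kappa> * (norm v)\<^sup>2 \<le> (\<kappa> + \<mu>) * inner u v"
    by (simp add: power2_norm_eq_inner inner_diff_left inner_diff_right inner_commute algebra_simps)
  also have "\<dots> \<le> (\<kappa> + \<mu>) * (norm u * norm v)"
    using assms by (intro mult_left_mono norm_cauchy_schwarz) auto
  finally have key: "(norm u - norm v) * (\<mu> * norm u - \<kappa> * norm v) \<le> 0"
    by (simp add: power2_eq_square algebra_simps)
  have "\<mu> * norm u \<le> \<kappa> * norm v \<and> norm v \<le> norm u"
  proof (cases "norm v \<le> norm u")
    case True
    show ?thesis
    proof (cases "norm u = norm v")
      case True then show ?thesis using assms by (simp add: mult_right_mono)
    next
      case False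
      then have "0 < norm u - norm v" using True by simp
      then show ?thesis using key True by (simp add: mult_le_0_iff)
    qed
  next
    \<comment> \<open>If |u| < |v|, then \<mu>|u| < \<kappa>|v| as well: both factors are negative
      and the product is positive.\<close>
    case False
    then have "\<mu> * norm u < \<kappa> * norm v" using assms
      by (intro mult_le_less_imp_less) auto
    then have "0 < (norm u - norm v) * (\<mu> * norm u - \<kappa> * norm v)"
      using False by (intro mult_neg_neg) auto
    then show ?thesis using key by simp
  qed
  then show "norm (x - resolvent T \<mu> x) \<le> norm (x - resolvent T \<kappa> x)"
    and "\<mu> * norm (x - resolvent T \<kappa> x) \<le> \<kappa> * norm (x - resolvent T \<mu> x)"
    unfolding pu qv using assms \<open>0 < \<kappa>\<close> by auto
qed

text \<open>Reduces all parameters to J_1. The comparison yields the factor max 1 \<beta>; it is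
  relaxed to the 2 that occurs in \<open>nu\<close>.\<close>

lemma resolvent_displacement_le_max:
  assumes "0 < \<beta>"
  shows "norm (x - resolvent T \<beta> x) \<le> max 2 \<beta> * norm (x - resolvent T 1 x)"
proof -
  have "norm (x - resolvent T \<beta> x) \<le> max 1 \<beta> * norm (x - resolvent T 1 x)"
  proof (cases "\<beta> \<le> 1")
    case True
    then show ?thesis using resolvent_displacement_mono(1)[OF assms True] by (simp add: max_absorb1)
  next
    case False
    then show ?thesis using resolvent_displacement_mono(2)[of 1 \<beta> x] by simp
  qed
  also have "\<dots> \<le> max 2 \<beta> * norm (x - resolvent T 1 x)" by (intro mult_right_mono) auto
  finally show ?thesis .
qed

end

section \<open>Convexity, minimisation and recursion estimates, then their use on the
  iteration\<close>

section \<open>Halpern-type proximal point iteration\<close>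

text \<open>Quantitative convexity of the fixed point set. J w is almost as close to y and to z as w
  is, and a point that close to both ends of a segment must be near w.\<close>

lemma approx_fixed_point_convex:
  fixes J :: "'x::real_inner \<Rightarrow> 'x"
  assumes J: "\<And>y z. norm (J y - J z) \<le> norm (y - z)"
    and y: "norm (y - J y) \<le> \<delta>" and z: "norm (z - J z) \<le> \<delta>"
    and L: "norm (y - z) \<le> L" and t: "0 \<le> t" "t \<le> 1"
    and w: "w = (1 - t) *\<^sub>R y + t *\<^sub>R z"
  shows "(norm (w - J w))\<^sup>2 \<le> L * \<delta> + \<delta>\<^sup>2"
proof -
  let ?l = "norm (y - z)"
  have "0 \<le> \<delta>" using y norm_ge_zero order_trans by blast
  have "w - y = t *\<^sub>R (z - y)" "w - z = (1 - t) *\<^sub>R (y - z)"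
    unfolding w by (simp_all add: algebra_simps)
  then have n: "norm (w - y) = t * ?l" "norm (w - z) = (1 - t) * ?l"
    using t by (simp_all add: norm_minus_commute)
  have "norm (J w - y) \<le> norm (J w - J y) + norm (J y - y)"
    using norm_triangle_ineq[of "J w - J y" "J y - y"] by simp
  then have a: "norm (J w - y) \<le> t * ?l + \<delta>" using J[of w y] y n by (simp add: norm_minus_commute)
  have "norm (J w - z) \<le> norm (J w - J z) + norm (J z - z)"
    using norm_triangle_ineq[of "J w - J z" "J z - z"] by simp
  then have b: "norm (J w - z) \<le> (1 - t) * ?l + \<delta>" using J[of w z] z n by (simp add: norm_minus_commute)
  \<comment> \<open>Stewart's identity for the point w of the segment; in the bound the terms
    quadratic in |y - z| cancel.\<close>
  have "(norm (w - J w))\<^sup>2 = (1 - t) * (norm (J w - y))\<^sup>2 + t * (norm (J w - z))\<^sup>2 - t * (1 - t) * ?l\<^sup>2"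
    unfolding w power2_norm_eq_inner
    by (simp add: inner_diff_left inner_diff_right inner_add_left inner_add_right inner_commute algebra_simps)
  also have "\<dots> \<le> (1 - t) * (t * ?l + \<delta>)\<^sup>2 + t * ((1 - t) * ?l + \<delta>)\<^sup>2 - t * (1 - t) * ?l\<^sup>2"
    using t by (intro diff_right_mono add_mono mult_left_mono power_mono a b) auto
  also have "\<dots> = 4 * t * (1 - t) * (?l * \<delta>) + \<delta>\<^sup>2"
    by (simp add: power2_eq_square algebra_simps)
  also have "\<dots> \<le> 1 * (L * \<delta>) + \<delta>\<^sup>2"
  proof -
    have "0 \<le> (1 - 2 * t)\<^sup>2" by simp
    then have "4 * t * (1 - t) \<le> 1" by (simp add: power2_eq_square algebra_simps)
    moreover have "?l * \<delta> \<le> L * \<delta>" using L \<open>0 \<le> \<delta>\<close> by (rule mult_right_mono)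
    ultimately have "4 * t * (1 - t) * (?l * \<delta>) \<le> 1 * (L * \<delta>)"
      using \<open>0 \<le> \<delta>\<close> by (intro mult_mono[of "4 * t * (1 - t)"]) auto
    then show ?thesis by simp
  qed
  finally show ?thesis by simp
qed

text \<open>Otherwise every candidate could be improved by more than \<epsilon>, and R improvements
  starting from p would make \<phi> negative.\<close>

lemma approx_minimizer:
  fixes F :: "nat \<Rightarrow> 'a set" and \<phi> :: "'a \<Rightarrow> real" and w :: "nat \<Rightarrow> nat"
  assumes p: "\<And>n. p \<in> F n" and nn: "\<And>y. 0 \<le> \<phi> y" and R: "\<phi> p < real R * \<epsilon>"
  obtains i y where "i < R" "y \<in> F (w ((w ^^ i) 0))" "\<And>z. z \<in> F ((w ^^ i) 0) \<Longrightarrow> \<phi> y \<le> \<phi> z + \<epsilon>"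
proof (rule ccontr)
  assume "\<not> thesis"
  with that have *: "\<exists>z\<in>F ((w ^^ i) 0). \<phi> z + \<epsilon> < \<phi> y" if "i < R" "y \<in> F (w ((w ^^ i) 0))" for i y
    using \<open>i < R\<close> \<open>y \<in> _\<close> by (meson not_le)
  \<comment> \<open>The induction descends through the iterates of \<open>w\<close>: a point in
    \<open>F\<close> at iterate i+1 is improved by one in \<open>F\<close> at iterate i, which is
    again a candidate one level lower.\<close>
  have "j \<le> R \<Longrightarrow> \<exists>y\<in>F ((w ^^ (R - j)) 0). \<phi> y \<le> \<phi> p - real j * \<epsilon>" for j
  proof (induction j)
    case 0
    then show ?case using p by force
  next
    case (Suc j)
    then obtain y where y: "y \<in> F ((w ^^ (R - j)) 0)" "\<phi> y \<le> \<phi> p - real j * \<epsilon>" by auto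
    have "R - j = Suc (R - Suc j)" using Suc.prems by simp
    then have "y \<in> F (w ((w ^^ (R - Suc j)) 0))" using y(1) by simp
    from *[OF _ this] Suc.prems obtain z where "z \<in> F ((w ^^ (R - Suc j)) 0)" "\<phi> z + \<epsilon> < \<phi> y"
      by auto
    then show ?case using y(2) by (intro bexI[of _ z]) (auto simp: algebra_simps)
  qed
  from this[of R] obtain y where "\<phi> y \<le> \<phi> p - real R * \<epsilon>" by auto
  then show False using nn[of y] R by simp
qed

text \<open>Expand the square along the segment: approximate minimality becomes the first-order
  condition of a projection, with errors of order t^2 and \<epsilon>.\<close>

lemma variational_inequality_of_minimality:
  fixes x0 y z :: "'x::real_inner"
  assumes "(norm (x0 - y))\<^sup>2 \<le> (norm (x0 - ((1 - t) *\<^sub>R y + t *\<^sub>R z)))\<^sup>2 + \<epsilon>"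
  shows "2 * t * inner (x0 - y) (z - y) \<le> t\<^sup>2 * (norm (z - y))\<^sup>2 + \<epsilon>"
proof -
  have "x0 - ((1 - t) *\<^sub>R y + t *\<^sub>R z) = (x0 - y) - t *\<^sub>R (z - y)" by (simp add: algebra_simps)
  then have "(norm (x0 - ((1 - t) *\<^sub>R y + t *\<^sub>R z)))\<^sup>2
      = (norm (x0 - y))\<^sup>2 - 2 * t * inner (x0 - y) (z - y) + t\<^sup>2 * (norm (z - y))\<^sup>2"
    by (simp only: power2_norm_eq_inner inner_diff_left[of "x0 - y"] inner_diff_right[of _ "x0 - y"]
        inner_scaleR_left inner_scaleR_right)
      (simp add: inner_commute power2_eq_square algebra_simps)
  then show ?thesis using assms by linarith
qed

text \<open>The initial value decays through 1 - \<alpha> <= exp(-\<alpha>), the constant r is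
  preserved by convex combination, and the errors add up undamped.\<close>

lemma quasi_contraction_recursion_bound:
  fixes s \<alpha> \<delta> :: "nat \<Rightarrow> real"
  assumes step: "\<And>i. g \<le> i \<Longrightarrow> i < q \<Longrightarrow> s (Suc i) \<le> (1 - \<alpha> i) * s i + \<alpha> i * r + \<delta> i"
    and \<alpha>: "\<And>i. 0 \<le> \<alpha> i \<and> \<alpha> i \<le> 1" and \<delta>: "\<And>i. 0 \<le> \<delta> i" and r: "0 \<le> r"
    and C: "s g \<le> C" "0 \<le> C" and i: "g \<le> i" "i \<le> q"
  shows "s i \<le> C * exp (- (\<Sum>j=g..<i. \<alpha> j)) + r + (\<Sum>j=g..<i. \<delta> j)"
  using i
proof (induction i rule: dec_induct)
  case base
  then show ?case using C r by simp
next
  case (step i)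
  let ?X = "C * exp (- (\<Sum>j=g..<i. \<alpha> j))" and ?S = "\<Sum>j=g..<i. \<delta> j"
  have "s (Suc i) \<le> (1 - \<alpha> i) * s i + \<alpha> i * r + \<delta> i"
    using step assms(1) by simp
  also have "\<dots> \<le> (1 - \<alpha> i) * (?X + r + ?S) + \<alpha> i * r + \<delta> i"
    using step \<alpha>[of i] by (intro add_right_mono mult_left_mono) auto
  also have "\<dots> = (1 - \<alpha> i) * ?X + r + (1 - \<alpha> i) * ?S + \<delta> i" by (simp add: algebra_simps)
  also have "\<dots> \<le> exp (- \<alpha> i) * ?X + r + 1 * ?S + \<delta> i"
    using \<alpha>[of i] \<delta> C(2) exp_ge_add_one_self[of "- \<alpha> i"]
    by (intro add_mono mult_right_mono) (auto intro: sum_nonneg mult_nonneg_nonneg)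
  also have "\<dots> = C * exp (- (\<Sum>j=g..<Suc i. \<alpha> j)) + r + (\<Sum>j=g..<Suc i. \<delta> j)"
    using step by (simp add: exp_add[symmetric] mult_ac)
  finally show ?case .
qed

section \<open>The iteration under the given moduli: boundedness and rates\<close>

locale halpern_ppa =
  fixes T :: "'x::{real_inner, complete_space} \<Rightarrow> 'x set"
    and \<alpha> \<beta> :: "nat \<Rightarrow> real" and e x :: "nat \<Rightarrow> 'x"
    and a A b B E :: "nat \<Rightarrow> nat" and D Ec :: nat and p :: 'x
  assumes maxmon: "maximal_monotone T"
    and alpha_range: "\<And>n. 0 < \<alpha> n \<and> \<alpha> n < 1"
    and beta_pos: "\<And>n. 0 < \<beta> n"
    and HPPA: "\<And>n. x (Suc n) = \<alpha> n *\<^sub>R x 0 + (1 - \<alpha> n) *\<^sub>R (resolvent T (\<beta> n) (x n) + e n)"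
    and mono_a: "mono a" and mono_A: "mono A" and mono_b: "mono b"
    and mono_B: "mono B" and mono_E: "mono E"
    and Q1: "\<And>k n. n \<ge> a k \<Longrightarrow> \<alpha> n \<le> 1 / (real k + 1)"
    and Q2: "\<And>k. (\<Sum>i=0..A k. \<alpha> i) \<ge> real k"
    and Q3': "\<And>n. \<beta> n \<le> real (b n)"
    and Q3: "\<And>k n. n \<ge> B k \<Longrightarrow> \<beta> n \<ge> real k"
    and Q4: "\<And>k n. (\<Sum>i=E k + 1..E k + n. norm (e i)) \<le> 1 / (real k + 1)"
    and Ec_bound: "real Ec \<ge> 1 + (\<Sum>i=0..E 0. norm (e i))"
    and p_zero: "p \<in> zeros T"
    and D_bound: "real D \<ge> norm (x 0 - p)"
begin

abbreviation "J \<equiv> resolvent T"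
abbreviation "N \<equiv> max (2 * D) (D + Ec)"
abbreviation "chi \<equiv> chi1 a B E D Ec"

lemma Ec_ge_1: "1 \<le> Ec"
proof -
  have "1 \<le> real Ec" using Ec_bound sum_nonneg[of "{0..E 0}" "\<lambda>i. norm (e i)"] by simp
  then show ?thesis by simp
qed

text \<open>Errors beyond index E(0) sum to at most 1, which is the 1 in the bound on
  \<open>Ec\<close>.\<close>

lemma sum_errors_le: "(\<Sum>i<n. norm (e i)) \<le> real Ec"
proof -
  have "(\<Sum>i<n. norm (e i)) \<le> (\<Sum>i\<in>{0..E 0} \<union> {E 0 + 1..E 0 + n}. norm (e i))"
    by (intro sum_mono2) auto
  also have "\<dots> = (\<Sum>i=0..E 0. norm (e i)) + (\<Sum>i=E 0 + 1..E 0 + n. norm (e i))"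
    by (intro sum.union_disjoint) auto
  also have "\<dots> \<le> real Ec" using Q4[of 0 n] Ec_bound by simp
  finally show ?thesis .
qed

lemma tail_errors_le:
  assumes "E k + 1 \<le> g"
  shows "(\<Sum>i=g..<q. norm (e i)) \<le> 1 / (real k + 1)"
proof -
  have "(\<Sum>i=g..<q. norm (e i)) \<le> (\<Sum>i=E k + 1..E k + q. norm (e i))"
    using assms by (intro sum_mono2) auto
  then show ?thesis using Q4[of k q] by simp
qed

lemma error_le: "E k + 1 \<le> n \<Longrightarrow> norm (e n) \<le> 1 / (real k + 1)"
  using tail_errors_le[of k n "Suc n"] by simp

lemma J_p: "0 < \<gamma> \<Longrightarrow> J \<gamma> p = p"
  using resolvent_zero[OF maxmon _ p_zero] .

lemma J_nonexp: "0 < \<gamma> \<Longrightarrow> norm (J \<gamma> y - J \<gamma> z) \<le> norm (y - z)"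
  using resolvent_nonexpansive[OF maxmon] .

lemma J_dist_p: "0 < \<gamma> \<Longrightarrow> norm (J \<gamma> y - p) \<le> norm (y - p)"
  using J_nonexp[of \<gamma> y p] J_p by simp

lemma dist_p_sum: "norm (x n - p) \<le> real D + (\<Sum>i<n. norm (e i))"
proof (induction n)
  case 0
  then show ?case using D_bound by simp
next
  case (Suc n)
  let ?S = "\<Sum>i<n. norm (e i)"
  have "x (Suc n) - p = \<alpha> n *\<^sub>R (x 0 - p) + (1 - \<alpha> n) *\<^sub>R (J (\<beta> n) (x n) - p + e n)"
    by (simp add: HPPA algebra_simps)
  also have "norm \<dots> \<le> \<alpha> n * norm (x 0 - p) + (1 - \<alpha> n) * norm (J (\<beta> n) (x n) - p + e n)"
    using alpha_range[of n] by (intro norm_triangle_le) simp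
  also have "\<dots> \<le> \<alpha> n * (real D + ?S + norm (e n)) + (1 - \<alpha> n) * (real D + ?S + norm (e n))"
  proof (intro add_mono mult_left_mono)
    have "0 \<le> ?S" by (intro sum_nonneg) simp
    then show "norm (x 0 - p) \<le> real D + ?S + norm (e n)" using D_bound norm_ge_zero[of "e n"] by linarith
    show "norm (J (\<beta> n) (x n) - p + e n) \<le> real D + ?S + norm (e n)"
      using J_dist_p[OF beta_pos, of n "x n"] Suc.IH by (intro norm_triangle_le) simp
  qed (use alpha_range[of n] in auto)
  finally show ?case by (simp add: algebra_simps)
qed

lemma dist_p: "norm (x n - p) \<le> real (D + Ec)"
  using dist_p_sum[of n] sum_errors_le[of n] by simp

text \<open>The difference is \<alpha>_n (x_0 - y) + (1 - \<alpha>_n) e_n with y the resolvent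
  value; the thresholds in \<open>xi\<close> allot half of the tolerance to each term.\<close>

lemma xi_rate:
  assumes "xi a E D Ec k \<le> n"
  shows "norm (x (Suc n) - J (\<beta> n) (x n)) \<le> 1 / (real k + 1)"
proof -
  let ?y = "J (\<beta> n) (x n)" and ?m = "2 * (2 * D + Ec) * (k + 1) - 1"
  \<comment> \<open>Bounds |x_0 - y|: x_0 is within D of p and y within D + Ec.\<close>
  define M where "M = 2 * real D + real Ec"
  have M: "0 < M" using Ec_ge_1 by (simp add: M_def)
  have "2 * (2 * D + Ec) * (k + 1) \<ge> 1" using Ec_ge_1 by simp
  then have m: "real ?m + 1 = 2 * M * (real k + 1)" by (simp add: M_def of_nat_diff algebra_simps)
  have "\<alpha> n \<le> 1 / (2 * M * (real k + 1))"
    using assms Q1[of ?m n] unfolding m by (simp add: xi_def)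
  then have "\<alpha> n * M \<le> 1 / (2 * M * (real k + 1)) * M" using M by (intro mult_right_mono) auto
  then have al: "\<alpha> n * M \<le> 1 / (2 * (real k + 1))" using M by simp
  have er: "norm (e n) \<le> 1 / (2 * (real k + 1))"
    using assms error_le[of "2 * k + 1" n] by (simp add: xi_def algebra_simps)
  have "norm (x 0 - ?y) \<le> norm (x 0 - p) + norm (?y - p)"
    using norm_triangle_ineq4[of "x 0 - p" "?y - p"] by simp
  also have "\<dots> \<le> M" using D_bound J_dist_p[OF beta_pos, of n "x n"] dist_p[of n] by (simp add: M_def)
  finally have d: "norm (x 0 - ?y) \<le> M" .
  have "x (Suc n) - ?y = \<alpha> n *\<^sub>R (x 0 - ?y) + (1 - \<alpha> n) *\<^sub>R e n"
    by (simp add: HPPA algebra_simps)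
  also have "norm \<dots> \<le> \<alpha> n * norm (x 0 - ?y) + (1 - \<alpha> n) * norm (e n)"
    using alpha_range[of n] by (intro norm_triangle_le) simp
  also have "\<dots> \<le> \<alpha> n * M + 1 * norm (e n)"
    using alpha_range[of n] d by (intro add_mono mult_left_mono mult_right_mono) auto
  also have "\<dots> \<le> 1 / (2 * (real k + 1)) + 1 / (2 * (real k + 1))" using al er by simp
  also have "\<dots> = 1 / (real k + 1)" by (simp add: field_simps)
  finally show ?thesis .
qed

text \<open>The resolvent point y of the previous step is near x_n, and it is nearly fixed by J_1
  because (x_m - y)/\<beta>_m is a value of \<open>T\<close> at y, small for large \<beta>_m.
  Passing from y to x_n costs twice their distance.\<close>

lemma chi1_rate:
  assumes "chi k \<le> n"
  shows "norm (x n - J 1 (x n)) \<le> 1 / (real k + 1)"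
proof -
  \<comment> \<open>The final +1 in \<open>chi1\<close> makes n a successor whose predecessor m has
    passed both thresholds.\<close>
  have "1 \<le> n" using assms by (simp add: chi1_def)
  then obtain m where n: "n = Suc m" by (cases n) auto
  let ?l = "8 * (D + Ec) * (k + 1) - 1" and ?y = "J (\<beta> m) (x m)"
  define M where "M = real (D + Ec)"
  have M: "1 \<le> M" using Ec_ge_1 by (simp add: M_def)
  have "xi a E D Ec (4 * k + 3) \<le> m" and Bl: "B ?l \<le> m" using assms by (auto simp: chi1_def n)
  from xi_rate[OF this(1)] have 1: "norm (x n - ?y) \<le> 1 / (4 * (real k + 1))"
    by (simp add: n algebra_simps)
  have "8 * (D + Ec) * (k + 1) \<ge> 1" using Ec_ge_1 by simp
  then have l: "real ?l = 8 * M * (real k + 1) - 1" by (simp add: M_def of_nat_diff algebra_simps)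
  have "1 \<le> M * (real k + 1)" using M mult_mono[of 1 M 1 "real k + 1"] by simp
  \<comment> \<open>The -1 in the argument of \<open>B\<close> is absorbed by halving the factor
    8.\<close>
  then have be: "4 * M * (real k + 1) \<le> \<beta> m" using Q3[OF Bl] unfolding l by linarith
  obtain u where u: "u \<in> T ?y" "x m = ?y + \<beta> m *\<^sub>R u" using resolvent_cases[OF maxmon beta_pos] .
  have "\<beta> m * norm u = norm (x m - ?y)" using u(2) beta_pos[of m]
    by (metis abs_of_pos add_diff_cancel_left' norm_scaleR)
  also have "\<dots> \<le> norm (x m - p) + norm (?y - p)"
    using norm_triangle_ineq4[of "x m - p" "?y - p"] by simp
  also have "\<dots> \<le> 2 * M" using J_dist_p[OF beta_pos, of m "x m"] dist_p[of m] by (simp add: M_def)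
  finally have "4 * M * (real k + 1) * norm u \<le> 2 * M"
    using mult_right_mono[OF be norm_ge_zero[of u]] by linarith
  moreover have "(2 * M) * (norm u * (2 * (real k + 1))) = 4 * M * (real k + 1) * norm u"
    by algebra
  ultimately have "(2 * M) * (norm u * (2 * (real k + 1))) \<le> (2 * M) * 1" by linarith
  then have "norm u * (2 * (real k + 1)) \<le> 1" using M mult_le_cancel_left_pos[of "2 * M"] by simp
  then have "norm u \<le> 1 / (2 * (real k + 1))" by (simp add: pos_le_divide_eq)
  then have 2: "norm (?y - J 1 ?y) \<le> 1 / (2 * (real k + 1))"
    using resolvent_displacement_le[OF maxmon _ u(1), of 1] by simp
  have "x n - J 1 (x n) = (x n - ?y) + (?y - J 1 ?y) + (J 1 ?y - J 1 (x n))" by simp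
  also have "norm \<dots> \<le> norm (x n - ?y) + norm (?y - J 1 ?y) + norm (J 1 ?y - J 1 (x n))"
    by (meson norm_triangle_ineq norm_triangle_le add_right_mono order_trans)
  also have "\<dots> \<le> 2 * norm (x n - ?y) + norm (?y - J 1 ?y)"
    using J_nonexp[of 1 ?y "x n"] by (simp add: norm_minus_commute)
  also have "\<dots> \<le> 2 * (1 / (4 * (real k + 1))) + 1 / (2 * (real k + 1))" using 1 2 by simp
  also have "2 * (1 / (4 * c)) + 1 / (2 * c) = 1 / c" for c :: real by simp
  finally show ?thesis .
qed

lemma mono_chi1: "mono chi"
proof (rule monoI)
  fix k l :: nat assume "k \<le> l"
  then have "a (2 * (2 * D + Ec) * (4 * k + 3 + 1) - 1) \<le> a (2 * (2 * D + Ec) * (4 * l + 3 + 1) - 1)"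
    "E (2 * (4 * k + 3) + 1) \<le> E (2 * (4 * l + 3) + 1)"
    "B (8 * (D + Ec) * (k + 1) - 1) \<le> B (8 * (D + Ec) * (l + 1) - 1)"
    by (intro monoD[OF mono_a] monoD[OF mono_E] monoD[OF mono_B] diff_le_mono mult_le_mono; simp)+
  then show "chi k \<le> chi l" unfolding chi1_def xi_def by linarith
qed

end

text \<open>Expanding |y - \<alpha>d|^2 = (1 - \<alpha>)^2 |v|^2 bounds |y|^2 by (1 - \<alpha>)^2
  |v|^2 + 2\<alpha><d, y>; the error \<theta> in |v| then enters only linearly because \<theta> <=
  1.\<close>

lemma halpern_step_norm:
  fixes y v d :: "'x::real_inner"
  assumes y: "y = \<alpha> *\<^sub>R d + (1 - \<alpha>) *\<^sub>R v" and \<alpha>: "0 \<le> \<alpha>" "\<alpha> \<le> 1"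
    and v: "norm v \<le> s + \<theta>" and s: "0 \<le> s" "s \<le> L" and \<theta>: "0 \<le> \<theta>" "\<theta> \<le> 1"
    and r: "2 * inner d y \<le> r"
  shows "(norm y)\<^sup>2 \<le> (1 - \<alpha>) * s\<^sup>2 + \<alpha> * r + (1 + 2 * L) * \<theta>"
proof -
  have "(1 - \<alpha>)\<^sup>2 * (norm v)\<^sup>2 = (norm (y - \<alpha> *\<^sub>R d))\<^sup>2"
    by (simp add: y power_mult_distrib)
  also have "\<dots> = (norm y)\<^sup>2 - 2 * \<alpha> * inner d y + \<alpha>\<^sup>2 * (norm d)\<^sup>2"
    by (simp only: power2_norm_eq_inner inner_diff_left inner_diff_right inner_scaleR_left inner_scaleR_right
        inner_commute[of y d]) (simp add: power2_eq_square algebra_simps)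
  finally have "(norm y)\<^sup>2 \<le> (1 - \<alpha>)\<^sup>2 * (norm v)\<^sup>2 + \<alpha> * (2 * inner d y)"
    by (simp add: algebra_simps)
  also have "\<dots> \<le> (1 - \<alpha>) * (s + \<theta>)\<^sup>2 + \<alpha> * r"
  proof (rule add_mono)
    have "(1 - \<alpha>)\<^sup>2 \<le> 1 - \<alpha>" using \<alpha> mult_right_mono[of "1 - \<alpha>" 1 "1 - \<alpha>"]
      by (simp add: power2_eq_square)
    then show "(1 - \<alpha>)\<^sup>2 * (norm v)\<^sup>2 \<le> (1 - \<alpha>) * (s + \<theta>)\<^sup>2"
      using \<alpha> v by (intro mult_mono power_mono) auto
    show "\<alpha> * (2 * inner d y) \<le> \<alpha> * r" using \<alpha> r by (intro mult_left_mono)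
  qed
  also have "(s + \<theta>)\<^sup>2 \<le> s\<^sup>2 + (1 + 2 * L) * \<theta>"
  proof -
    have "\<theta> * (2 * s + \<theta>) \<le> \<theta> * (1 + 2 * L)" using s \<theta> by (intro mult_left_mono) auto
    then show ?thesis by (simp add: power2_eq_square algebra_simps)
  qed
  also have "(1 - \<alpha>) * (s\<^sup>2 + (1 + 2 * L) * \<theta>) \<le> (1 - \<alpha>) * s\<^sup>2 + (1 + 2 * L) * \<theta>"
    using \<alpha> s \<theta> mult_right_mono[of "1 - \<alpha>" 1 "(1 + 2 * L) * \<theta>"] by (simp add: ring_distribs)
  finally show ?thesis using \<alpha> by (simp add: mult_left_mono)
qed

section \<open>Approximate projection of the anchor and metastability\<close>

context halpern_ppa
begin

lemma N_ge_1: "1 \<le> N"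
  using Ec_ge_1 by simp

lemma dist_p_N: "norm (x n - p) \<le> real N"
  using dist_p[of n] by simp

text \<open>z replaces the projection of x_0 onto the zero set. Its variational inequality comes
  from comparing z with points on the segment towards x_j, which are admissible by approximate
  convexity.\<close>

lemma Psi_approx_projection:
  obtains n z where "n \<le> Psi a b B E D Ec N k u" "norm (z - p) \<le> real N"
    "\<And>i. i \<le> u n \<Longrightarrow> norm (z - J (\<beta> i) z) \<le> 1 / (real (u n) + 1)"
    "\<And>j. n \<le> j \<Longrightarrow> inner (x 0 - z) (x j - z) \<le> 1 / (real k + 1)"
proof -
  define w where "w = wfun (\<lambda>m. nu b u (chi m)) N"
  define R where "R = 4 * N^4 * (k + 1)^2"
  \<comment> \<open>The ball around p keeps z within 2N of every x_j.\<close>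
  define F where "F m = {y. norm (y - p) \<le> real N \<and> norm (y - J 1 y) \<le> 1 / (real m + 1)}" for m
  define K where "K = real k + 1"
  define M where "M = real N"
  define \<epsilon> where "\<epsilon> = 1 / (4 * M\<^sup>2 * K\<^sup>2)"
  have K: "1 \<le> K" by (simp add: K_def)
  have M: "1 \<le> M" unfolding M_def using N_ge_1 by linarith
  have R: "real R * \<epsilon> = M\<^sup>2"
  proof -
    have "real R = (4 * M\<^sup>2 * K\<^sup>2) * M\<^sup>2"
      by (simp add: R_def M_def K_def power2_eq_square power4_eq_xxxx algebra_simps del: of_nat_max)
    then show ?thesis using K M by (simp add: \<epsilon>_def)
  qed
  \<comment> \<open>\<open>approx_minimizer\<close> needs strictness, which holds since Ec >= 1
    gives D < D + Ec.\<close>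
  have "norm (x 0 - p) < M"
  proof -
    have "D < N" using Ec_ge_1 by auto
    then show ?thesis unfolding M_def using D_bound by linarith
  qed
  then have "(norm (x 0 - p))\<^sup>2 < real R * \<epsilon>" unfolding R by (intro power_strict_mono) auto
  from approx_minimizer[of p F "\<lambda>y. (norm (x 0 - y))\<^sup>2", OF _ _ this, of w]
  obtain i z where i: "i < R" and z: "z \<in> F (w ((w ^^ i) 0))"
    and min: "\<And>y. y \<in> F ((w ^^ i) 0) \<Longrightarrow> (norm (x 0 - z))\<^sup>2 \<le> (norm (x 0 - y))\<^sup>2 + \<epsilon>"
    by (auto simp: F_def J_p)
  define m where "m = (w ^^ i) 0"
  define l where "l = 24 * N * (m + 1)^2"
  define n where "n = chi l"
  define \<delta> where "\<delta> = 1 / (real l + 1)"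
  \<comment> \<open>The number i of the successful stage is unknown, so its iterate is bounded by
    the R-th one; \<open>w\<close> never decreases its argument.\<close>
  have "mono (\<lambda>i. (w ^^ i) 0)"
  proof (rule mono_iff_le_Suc[THEN iffD2], rule allI)
    fix i
    let ?q = "(w ^^ i) 0"
    have "?q + 1 \<le> (?q + 1)^2" by (simp add: power2_eq_square)
    also have "\<dots> \<le> 24 * N * (?q + 1)^2" using N_ge_1 by simp
    also have "\<dots> \<le> w ?q" unfolding w_def wfun_def by simp
    finally show "(w ^^ i) 0 \<le> (w ^^ Suc i) 0" by simp
  qed
  from monoD[OF this, of i R] i have "m \<le> (w ^^ R) 0" by (simp add: m_def)
  then have "l \<le> 24 * N * ((w ^^ R) 0 + 1)^2" unfolding l_def by (intro mult_left_mono power_mono) auto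
  then have nPsi: "n \<le> Psi a b B E D Ec N k u"
    unfolding n_def Psi_def Let_def w_def[symmetric] R_def[symmetric] by (rule monoD[OF mono_chi1])
  have zp: "norm (z - p) \<le> M" and zw: "norm (z - J 1 z) \<le> 1 / (real (w m) + 1)"
    using z by (simp_all add: F_def m_def M_def)
  \<comment> \<open>The maximum in \<open>wfun\<close> serves two demands: precision for the
    counterfunction, and precision \<delta> for the convexity argument.\<close>
  have wm: "nu b u n \<le> w m" "l \<le> w m" by (simp_all add: w_def wfun_def l_def n_def)
  have z_nu: "norm (z - J (\<beta> i) z) \<le> 1 / (real (u n) + 1)" if i: "i \<le> u n" for i
  proof -
    let ?c = "max 2 (b (u n))"
    have "1 \<le> ?c * (u n + 1)" by (simp add: Suc_le_eq less_max_iff_disj)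
    then have nu: "real (nu b u n) + 1 = real ?c * (real (u n) + 1)"
      by (simp add: nu_def of_nat_diff del: of_nat_max) (simp add: algebra_simps)
    have "\<beta> i \<le> real (b (u n))"
      using Q3'[of i] monoD[OF mono_b i] by linarith
    then have c: "max 2 (\<beta> i) \<le> real ?c" by auto
    have "norm (z - J (\<beta> i) z) \<le> max 2 (\<beta> i) * norm (z - J 1 z)"
      by (rule resolvent_displacement_le_max[OF maxmon beta_pos])
    also have "\<dots> \<le> real ?c * (1 / (real (nu b u n) + 1))"
    proof (intro mult_mono c)
      show "norm (z - J 1 z) \<le> 1 / (real (nu b u n) + 1)"
        using wm(1) by (intro order_trans[OF zw] divide_left_mono) auto
    qed auto
    also have "\<dots> = 1 / (real (u n) + 1)"
      unfolding nu by (simp del: of_nat_max)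
    finally show ?thesis .
  qed
  have z\<delta>: "norm (z - J 1 z) \<le> \<delta>"
    unfolding \<delta>_def using wm(2) by (intro order_trans[OF zw] divide_left_mono) auto
  \<comment> \<open>Since \<delta> <= 1 <= M, the left side is at most 3M\<delta>, and the 24 in l
    makes this at most an eighth of the right side.\<close>
  have \<delta>m: "2 * M * \<delta> + \<delta>\<^sup>2 \<le> (1 / (real m + 1))\<^sup>2"
  proof -
    define c where "c = (real m + 1)\<^sup>2"
    have c: "1 \<le> c" by (simp add: c_def)
    have l: "real l = 24 * M * c" by (simp add: l_def M_def c_def del: of_nat_max)
    have Mc: "1 \<le> M * c" using M c mult_mono[of 1 M 1 c] by simp
    have "0 \<le> \<delta>" by (simp add: \<delta>_def)
    have "\<delta> \<le> 1 / (24 * M * c)" unfolding \<delta>_def l using Mc by (intro divide_left_mono) auto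
    then have "M * \<delta> \<le> M * (1 / (24 * M * c))" using M by (intro mult_left_mono) auto
    also have "\<dots> = (1 / c) / 24" using M by simp
    finally have 1: "M * \<delta> \<le> (1 / c) / 24" .
    have "\<delta> \<le> 1" by (simp add: \<delta>_def)
    then have "\<delta> * \<delta> \<le> M * \<delta>" using M \<open>0 \<le> \<delta>\<close> by (intro mult_right_mono) auto
    then have "2 * M * \<delta> + \<delta>\<^sup>2 \<le> 3 * ((1 / c) / 24)" using 1 by (simp add: power2_eq_square)
    also have "\<dots> \<le> 1 / c"
    proof -
      have *: "3 * (y / 24) \<le> y" if "0 \<le> y" for y :: real using that by simp
      show ?thesis by (rule *) (use c in simp)
    qed
    finally show ?thesis by (simp add: c_def power_one_over)
  qed
  have "inner (x 0 - z) (x j - z) \<le> 1 / (real k + 1)" if j: "n \<le> j" for j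
  proof -
    \<comment> \<open>this choice equalises the two error terms in the variational inequality\<close>
    define t where "t = 1 / (4 * M\<^sup>2 * K)"
    have MK: "1 \<le> 4 * M\<^sup>2 * K" using M K mult_mono[of 1 "M\<^sup>2" 1 K] by (simp add: one_le_power)
    have "0 < 1 / X \<and> 1 / X \<le> 1" if "1 \<le> X" for X :: real using that by simp
    from this[OF MK] have t: "0 < t" "t \<le> 1" by (simp_all only: t_def)
    let ?y = "(1 - t) *\<^sub>R z + t *\<^sub>R x j"
    have zx: "norm (z - x j) \<le> 2 * M"
      using norm_triangle_ineq4[of "z - p" "x j - p"] zp dist_p_N[of j] by (simp add: M_def del: of_nat_max)
    have "norm (x j - J 1 (x j)) \<le> \<delta>"
      using chi1_rate[of l j] j by (simp add: \<delta>_def n_def)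
    from approx_fixed_point_convex[OF J_nonexp z\<delta> this zx _ t(2) refl] t(1)
    have "(norm (?y - J 1 ?y))\<^sup>2 \<le> 2 * M * \<delta> + \<delta>\<^sup>2" by simp
    also have "\<dots> \<le> (1 / (real m + 1))\<^sup>2" by (rule \<delta>m)
    finally have "norm (?y - J 1 ?y) \<le> 1 / (real m + 1)" by (rule power2_le_imp_le) simp
    moreover have "?y \<in> cball p M"
      using zp dist_p_N[of j] t
      by (intro convexD[OF convex_cball]) (auto simp: dist_norm norm_minus_commute M_def)
    ultimately have "?y \<in> F m" by (simp add: F_def dist_norm norm_minus_commute M_def)
    then have "(norm (x 0 - z))\<^sup>2 \<le> (norm (x 0 - ?y))\<^sup>2 + \<epsilon>" by (intro min) (simp add: m_def)
    from variational_inequality_of_minimality[OF this]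
    have "2 * t * inner (x 0 - z) (x j - z) \<le> t\<^sup>2 * (norm (x j - z))\<^sup>2 + \<epsilon>" .
    also have "\<dots> \<le> t\<^sup>2 * (2 * M)\<^sup>2 + \<epsilon>"
      using zx by (intro add_right_mono mult_left_mono power_mono) (auto simp: norm_minus_commute)
    also have "\<dots> = 2 * t * (1 / K)"
      using M K by (simp add: t_def \<epsilon>_def power2_eq_square field_simps)
    finally have "2 * t * inner (x 0 - z) (x j - z) \<le> 2 * t * (1 / K)" .
    then have "inner (x 0 - z) (x j - z) \<le> 1 / K"
      by (rule mult_left_le_imp_le) (use t(1) in simp)
    then show ?thesis by (simp only: K_def)
  qed
  with nPsi zp z_nu show thesis by (intro that[of n z]) (auto simp: M_def)
qed

text \<open>Each \<alpha>_j is below 1, so the first g terms use up at most g of the total g +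
  c.\<close>

lemma sum_steps_ge:
  assumes "A (g + c) + 1 \<le> i"
  shows "g \<le> i" "real c \<le> (\<Sum>j=g..<i. \<alpha> j)"
proof -
  have "real (g + c) \<le> (\<Sum>j=0..A (g + c). \<alpha> j)" by (rule Q2)
  also have "\<dots> \<le> (\<Sum>j=0..<i. \<alpha> j)"
    using assms alpha_range by (intro sum_mono2) (auto intro: less_imp_le)
  finally have 1: "real (g + c) \<le> (\<Sum>j=0..<i. \<alpha> j)" .
  have le: "(\<Sum>j=0..<q. \<alpha> j) \<le> real q" for q
    using sum_bounded_above[of "{0..<q}" \<alpha> 1] alpha_range by (auto intro: less_imp_le)
  show g: "g \<le> i" using 1 le[of i] by simp
  have "(\<Sum>j=0..<i. \<alpha> j) = (\<Sum>j=0..<g. \<alpha> j) + (\<Sum>j=g..<i. \<alpha> j)"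
    using g by (simp add: sum.atLeastLessThan_concat)
  then show "real c \<le> (\<Sum>j=g..<i. \<alpha> j)" using 1 le[of g] by simp
qed

text \<open>The target (1/(2K))^2 is 4r with r = 1/(16K^2). One r each goes to the decayed initial
  distance, the inner product term, the at most q displacement errors \<eta>, and the tail of the
  e_j.\<close>

lemma metastable_neighbourhood:
  assumes zp: "norm (z - p) \<le> real N"
    and zfix: "\<And>i. i < q \<Longrightarrow> norm (z - J (\<beta> i) z) \<le> \<eta>"
    and \<eta>: "0 \<le> \<eta>" "(1 + 4 * real N) * (real q * \<eta>) \<le> 1 / (16 * (real k + 1)\<^sup>2)" "\<eta> \<le> 1 / 2"
    and var: "\<And>j. g \<le> j \<Longrightarrow> inner (x 0 - z) (x j - z) \<le> 1 / (32 * (real k + 1)\<^sup>2)"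
    and g: "E (16 * (1 + 4 * N) * (k + 1)^2 - 1) + 1 \<le> g"
    and i: "sigma1 A N (4 * (k + 1)^2 - 1) g \<le> i" "i \<le> q"
  shows "norm (x i - z) \<le> 1 / (2 * (real k + 1))"
proof -
  define K where "K = real k + 1"
  define M where "M = real N"
  define r where "r = 1 / (16 * K\<^sup>2)"
  define L where "L = 1 + 4 * M"
  have K: "1 \<le> K" by (simp add: K_def)
  have M: "1 \<le> M" unfolding M_def using N_ge_1 by linarith
  have L: "5 \<le> L" using M by (simp add: L_def)
  have "1 \<le> 16 * (1 + 4 * N) * (k + 1)^2" by (simp add: Suc_le_eq)
  then have Eq: "real (16 * (1 + 4 * N) * (k + 1)^2 - 1) + 1 = 16 * L * K\<^sup>2"
    by (simp add: of_nat_diff L_def M_def K_def del: of_nat_max)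
  have tail: "(\<Sum>j=g..<q'. norm (e j)) \<le> 1 / (16 * L * K\<^sup>2)" for q'
    using tail_errors_le[OF g, of q'] unfolding Eq .
  have r: "0 < r" "L * (1 / (16 * L * K\<^sup>2)) = r" using K L by (simp_all add: r_def)
  have "r \<le> 1 / 16" using K one_le_power[of K 2] by (simp add: r_def field_simps)
  \<comment> \<open>Together with \<eta> <= 1/2 this keeps the perturbation \<eta> + |e_j| at most
    1, as \<open>halpern_step_norm\<close> requires.\<close>
  have e_le: "norm (e j) \<le> 1 / 2" if "g \<le> j" for j
  proof -
    have "norm (e j) \<le> 1 / (16 * L * K\<^sup>2)" using tail_errors_le[OF g, of "Suc j"] error_le[of _ j] g that Eq
      by (metis order_trans)
    also have "\<dots> \<le> L * (1 / (16 * L * K\<^sup>2))"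
      using L mult_right_mono[of 1 L "1 / (16 * L * K\<^sup>2)"] by simp
    also have "\<dots> \<le> 1 / 2" using r(2) \<open>r \<le> 1 / 16\<close> by simp
    finally show ?thesis .
  qed
  have bd: "norm (x j - z) \<le> 2 * M" for j
    using norm_triangle_ineq4[of "x j - p" "z - p"] zp dist_p_N[of j] by (simp add: M_def del: of_nat_max)
  have step: "(norm (x (Suc j) - z))\<^sup>2 \<le> (1 - \<alpha> j) * (norm (x j - z))\<^sup>2 + \<alpha> j * r + L * (\<eta> + norm (e j))"
    if j: "g \<le> j" "j < q" for j
  proof -
    have "x (Suc j) - z = \<alpha> j *\<^sub>R (x 0 - z) + (1 - \<alpha> j) *\<^sub>R (J (\<beta> j) (x j) + e j - z)"
      by (simp add: HPPA algebra_simps)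
    moreover have "norm (J (\<beta> j) (x j) + e j - z) \<le> norm (x j - z) + (\<eta> + norm (e j))"
    proof -
      have "norm ((J (\<beta> j) (x j) - J (\<beta> j) z) + (J (\<beta> j) z - z) + e j)
        \<le> norm (J (\<beta> j) (x j) - J (\<beta> j) z) + norm (J (\<beta> j) z - z) + norm (e j)"
        by (meson add_right_mono norm_triangle_ineq norm_triangle_le order_trans)
      also have "\<dots> \<le> norm (x j - z) + \<eta> + norm (e j)"
        using zfix[OF j(2)] J_nonexp[OF beta_pos, of j "x j" z] by (simp add: norm_minus_commute)
      finally show ?thesis by (simp add: algebra_simps)
    qed
    moreover have "2 * inner (x 0 - z) (x (Suc j) - z) \<le> r"
      using var[of "Suc j"] j by (simp add: r_def K_def)
    ultimately have "(norm (x (Suc j) - z))\<^sup>2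
        \<le> (1 - \<alpha> j) * (norm (x j - z))\<^sup>2 + \<alpha> j * r + (1 + 2 * (2 * M)) * (\<eta> + norm (e j))"
      using alpha_range[of j] bd[of j] \<eta> e_le[OF j(1)]
      by (intro halpern_step_norm[where v = "J (\<beta> j) (x j) + e j - z"]) auto
    then show ?thesis by (simp add: L_def)
  qed
  \<comment> \<open>The logarithm in \<open>sigma1\<close>: exp(-c) is at most 1/(64 M^2 K^2), so
    (2M)^2 exp(-c) <= r.\<close>
  define c where "c = nat \<lceil>ln (real (16 * N^2 * (4 * (k + 1)^2 - 1 + 1)))\<rceil>"
  have "A (g + c) + 1 \<le> i" using i(1) by (simp add: sigma1_def c_def)
  note S = sum_steps_ge[OF this]
  have lnc: "ln (64 * M\<^sup>2 * K\<^sup>2) \<le> real c"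
  proof -
    have "1 \<le> 4 * (k + 1)^2" by (simp add: Suc_le_eq)
    then have eq: "real (16 * N^2 * (4 * (k + 1)^2 - 1 + 1)) = 64 * M\<^sup>2 * K\<^sup>2"
      by (simp add: M_def K_def del: of_nat_max) 
    show ?thesis unfolding c_def eq by (rule real_nat_ceiling_ge)
  qed
  have "(norm (x g - z))\<^sup>2 \<le> (2 * M)\<^sup>2" using bd by (intro power_mono) auto
  then have "(norm (x i - z))\<^sup>2 \<le> (2 * M)\<^sup>2 * exp (- (\<Sum>j=g..<i. \<alpha> j)) + r + (\<Sum>j=g..<i. L * (\<eta> + norm (e j)))"
    using step alpha_range \<eta>(1) L r(1) S(1) i(2)
    by (intro quasi_contraction_recursion_bound[where q = q]) (auto intro: less_imp_le)
  also have "\<dots> \<le> r + r + (r + r)"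
  proof (intro add_mono order_refl)
    have pos: "0 < 64 * M\<^sup>2 * K\<^sup>2" using M K by simp
    have "exp (- (\<Sum>j=g..<i. \<alpha> j)) \<le> exp (- ln (64 * M\<^sup>2 * K\<^sup>2))" using S(2) lnc by simp
    also have "\<dots> = 1 / (64 * M\<^sup>2 * K\<^sup>2)"
      using pos by (simp add: exp_minus inverse_eq_divide del: ln_mult)
    finally have "(2 * M)\<^sup>2 * exp (- (\<Sum>j=g..<i. \<alpha> j)) \<le> (2 * M)\<^sup>2 * (1 / (64 * M\<^sup>2 * K\<^sup>2))"
      by (intro mult_left_mono) auto
    also have "\<dots> = r" using M by (simp add: r_def power2_eq_square)
    finally show "(2 * M)\<^sup>2 * exp (- (\<Sum>j=g..<i. \<alpha> j)) \<le> r" .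
    have "(\<Sum>j=g..<i. L * (\<eta> + norm (e j))) = L * (real (i - g) * \<eta>) + L * (\<Sum>j=g..<i. norm (e j))"
      by (simp add: sum_distrib_left[symmetric] sum.distrib distrib_left)
    also have "\<dots> \<le> L * (real q * \<eta>) + L * (1 / (16 * L * K\<^sup>2))"
      using i(2) \<eta>(1) L tail by (intro add_mono mult_left_mono mult_right_mono) auto
    also have "\<dots> \<le> r + r" using \<eta>(2) r(2) by (simp add: L_def M_def r_def K_def)
    finally show "(\<Sum>j=g..<i. L * (\<eta> + norm (e j))) \<le> r + r" .
  qed
  also have "\<dots> = (1 / (2 * K))\<^sup>2" by (simp add: r_def power2_eq_square)
  finally show ?thesis unfolding K_def by (rule power2_le_imp_le) simp
qed

lemma metastability:
  "\<exists>n \<le> Phi1 a A b B E D Ec N k f.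
     \<forall>i \<in> {n..f n}. \<forall>j \<in> {n..f n}. norm (x i - x j) \<le> 1 / (real k + 1)"
proof -
  define kt where "kt = 4 * (k + 1)^2 - 1"
  define g where "g m = max m (E (16 * (1 + 4 * N) * (k + 1)^2 - 1) + 1)" for m
  \<comment> \<open>The argument of \<open>f\<close> is the left end of the interval that m would
    produce, so \<open>f\<close> gives its right end q. Precision 1/(h m + 1), summed over q steps
    and multiplied by 1 + 4N, stays within 1/(16(k+1)^2).\<close>
  define h where "h m = (1 + 4 * N) * (16 * (k + 1)^2 * (f (sigma1 A N kt (g m)) + 1) + 1) - 1" for m
  obtain n0 z where n0: "n0 \<le> Psi a b B E D Ec N (32 * (k + 1)^2 - 1) h" and zp: "norm (z - p) \<le> real N"
    and zfix: "\<And>i. i \<le> h n0 \<Longrightarrow> norm (z - J (\<beta> i) z) \<le> 1 / (real (h n0) + 1)"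
    and var: "\<And>j. n0 \<le> j \<Longrightarrow> inner (x 0 - z) (x j - z) \<le> 1 / (real (32 * (k + 1)^2 - 1) + 1)"
    by (rule Psi_approx_projection[of "32 * (k + 1)^2 - 1" h]) blast
  define n where "n = sigma1 A N kt (g n0)"
  define K where "K = real k + 1"
  define P where "P = real (f n) + 1"
  define L where "L = 1 + 4 * real N"
  have pos: "1 \<le> K" "1 \<le> P" "1 \<le> L" by (simp_all add: K_def P_def L_def)
  \<comment> \<open>n is built from the unknown n0; monotonicity of \<open>A\<close> and of
    \<open>g\<close> transfers the bound on n0 to \<open>Phi1\<close>.\<close>
  have "n \<le> sigma1 A N kt (g (Psi a b B E D Ec N (32 * (k + 1)^2 - 1) h))"
    unfolding n_def sigma1_def using n0 by (intro add_right_mono monoD[OF mono_A]) (auto simp: g_def)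
  also have "\<dots> = Phi1 a A b B E D Ec N k f"
    by (simp only: Phi1_def Let_def kt_def g_def[abs_def] h_def[abs_def])
  finally have n_le: "n \<le> Phi1 a A b B E D Ec N k f" .
  have "1 \<le> 32 * (k + 1)^2" by (simp add: Suc_le_eq)
  then have var': "inner (x 0 - z) (x j - z) \<le> 1 / (32 * (real k + 1)\<^sup>2)" if "g n0 \<le> j" for j
    using var[of j] that by (simp add: g_def of_nat_diff algebra_simps)
  have "1 \<le> (1 + 4 * N) * (16 * (k + 1)^2 * (f n + 1) + 1)" by (simp add: Suc_le_eq)
  then have h: "real (h n0) + 1 = L * (16 * K\<^sup>2 * P + 1)"
    unfolding h_def n_def[symmetric] L_def K_def P_def
    by (simp add: of_nat_diff algebra_simps del: of_nat_max)
  let ?\<eta> = "1 / (real (h n0) + 1)"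
  have X: "P \<le> K\<^sup>2 * P" using pos mult_right_mono[of 1 "K\<^sup>2" P] by (simp add: one_le_power)
  have big: "16 * K\<^sup>2 * P + 1 \<le> L * (16 * K\<^sup>2 * P + 1)"
    using pos mult_right_mono[of 1 L "16 * K\<^sup>2 * P + 1"] by simp
  have "real (f n) = P - 1" by (simp add: P_def)
  then have "real (f n) \<le> real (h n0)" using X h big pos by linarith
  \<comment> \<open>z is approximately fixed for indices up to h(n0), so this covers every step
    before f(n).\<close>
  then have fh: "f n \<le> h n0" by simp
  have \<eta>1: "L * (real (f n) * ?\<eta>) \<le> 1 / (16 * K\<^sup>2)"
  proof -
    have "L * (real (f n) * ?\<eta>) = real (f n) / (16 * K\<^sup>2 * P + 1)"
      unfolding h using pos by simp
    also have "\<dots> \<le> P / (16 * K\<^sup>2 * P)"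
      using pos by (intro frac_le) (auto simp: P_def)
    also have "\<dots> = 1 / (16 * K\<^sup>2)" using pos by simp
    finally show ?thesis .
  qed
  have \<eta>2: "?\<eta> \<le> 1 / 2"
  proof -
    have "2 \<le> real (h n0) + 1"
      using X h big pos by linarith
    then show ?thesis by (intro divide_left_mono) auto
  qed
  have near: "norm (x i - z) \<le> 1 / (2 * K)" if "i \<in> {n..f n}" for i
    unfolding K_def
  proof (rule metastable_neighbourhood[OF zp, of "f n" ?\<eta> k "g n0"])
    show "norm (z - J (\<beta> i) z) \<le> ?\<eta>" if "i < f n" for i
      using zfix that fh by simp
  qed (use that \<eta>1 \<eta>2 var' in \<open>auto simp: L_def K_def g_def n_def kt_def\<close>)
  have "norm (x i - x j) \<le> 1 / (real k + 1)" if "i \<in> {n..f n}" "j \<in> {n..f n}" for i j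
  proof -
    have "norm (x i - x j) \<le> norm (x i - z) + norm (x j - z)"
      using norm_triangle_ineq4[of "x i - z" "x j - z"] by simp
    also have "\<dots> \<le> 1 / (2 * K) + 1 / (2 * K)" using near that by (intro add_mono)
    also have "\<dots> = 1 / (real k + 1)" by (simp add: K_def field_simps)
    finally show ?thesis .
  qed
  with n_le show ?thesis by blast
qed

end

theorem mainTheorem13:
  fixes T :: "'x::{real_inner, complete_space} \<Rightarrow> 'x set"
    and \<alpha> \<beta> :: "nat \<Rightarrow> real" and e x :: "nat \<Rightarrow> 'x"
    and a A b B E :: "nat \<Rightarrow> nat" and D Ec :: nat and p :: 'x
  assumes maxmon: "maximal_monotone T"
    and alpha_range: "\<And>n. 0 < \<alpha> n \<and> \<alpha> n < 1"
    and beta_pos: "\<And>n. 0 < \<beta> n"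
    and HPPA: "\<And>n. x (Suc n) = \<alpha> n *\<^sub>R x 0 + (1 - \<alpha> n) *\<^sub>R (resolvent T (\<beta> n) (x n) + e n)"
    and mono_a: "mono a" and mono_A: "mono A" and mono_b: "mono b"
    and mono_B: "mono B" and mono_E: "mono E"
    and Q1: "\<And>k n. n \<ge> a k \<Longrightarrow> \<alpha> n \<le> 1 / (real k + 1)"
    and Q2: "\<And>k. (\<Sum>i=0..A k. \<alpha> i) \<ge> real k"
    and Q3': "\<And>n. \<beta> n \<le> real (b n)"
    and Q3: "\<And>k n. n \<ge> B k \<Longrightarrow> \<beta> n \<ge> real k"
    and Q4: "\<And>k n. (\<Sum>i=E k + 1..E k + n. norm (e i)) \<le> 1 / (real k + 1)"
    and Ec_bound: "real Ec \<ge> 1 + (\<Sum>i=0..E 0. norm (e i))"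
    and p_zero: "p \<in> zeros T"
    and D_bound: "real D \<ge> norm (x 0 - p)"
  shows "\<forall>k (f::nat \<Rightarrow> nat). mono f \<longrightarrow>
           (\<exists>n \<le> Phi1 a A b B E D Ec (max (2 * D) (D + Ec)) k f.
              \<forall>i \<in> {n..f n}. \<forall>j \<in> {n..f n}. norm (x i - x j) \<le> 1 / (real k + 1))"
proof -
  interpret halpern_ppa T \<alpha> \<beta> e x a A b B E D Ec p
    by (unfold_locales; fact assms)
  show ?thesis using metastability by blast
qed

end
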